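(* Let $S\in\mathcal A(f)$. Then $S$ admits a unique minimal $\mathcal A(f)$-system of generators $\operatorname{msg}_{\mathcal A(f)}(S)$, and $$\operatorname{msg}_{\mathcal A(f)}(S)=\operatorname{N}(S)\cap\operatorname{msg}(S).$$
   Context: Notation: $\mathbb N=\{0,1,2,\dots\}$, $p\ge 1$, and $\Lambda=\{e_1,\dots,e_p\}$ is the canonical basis of $\mathbb N^p$. $\mathcal C\subseteq\mathbb N^p$ is a fixed non-negative integer cone (the set of points of $\mathbb N^p$ lying in a finitely generated rational convex cone), with at least $p$ extremal rays. A $\mathcal C$-semigroup is a finitely generated submonoid $S\subseteq\mathcal C$ of $\mathbb N^p$ such that the minimal integer cone containing $S$ is $\mathcal C$ and $\mathcal H(S)=\mathcal C\setminus S$ is finite; $\operatorname{msg}(S)$ is its unique minimal generating set as a monoid. A monomial order $\preceq$ on $\mathbb N^p$ is fixed: a total order compatible with addition with $0\preceq x$ for all $x$; it is assumed that $\{x\in\mathcal C\mid x\preceq k\}$ is finite for every $k\in\mathcal C$. $\operatorname{Fb}(S)=\max_\preceq\mathcal H(S)$ (and $-\sum_i e_i$ if $\mathcal H(S)=\emptyset$), $\operatorname{N}(S)=\{x\in S\mid x\prec\operatorname{Fb}(S)\}$. A $\mathcal C$-semigroup $S$ is an $\mathcal A$-semigroup if for every $s\in S$ and $e\in\Lambda$ the set $\{s,s+e\}$ is not contained in $\operatorname{N}(S)$. An element $f\in\mathcal C\setminus\{0\}$ is fixed; $\mathcal A(f)$ is the set of all $\mathcal A$-semigroups $S$ with $\operatorname{Fb}(S)=f$,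 and $\Delta(f)=\{0\}\cup\{x\in\mathcal C\mid x\succ f\}$. A set $X$ is an $\mathcal A(f)$-set if $X\cap\Delta(f)=\emptyset$ and there is $S\in\mathcal A(f)$ with $X\subset S$. For an $\mathcal A(f)$-set $X$, $\mathcal A(f)[X]$ is the intersection of all elements of $\mathcal A(f)$ containing $X$. $X$ is an $\mathcal A(f)$-system of generators of $S$ if $X$ is an $\mathcal A(f)$-set and $S=\mathcal A(f)[X]$; it is minimal if moreover no proper subset $Y\subsetneq X$ satisfies $\mathcal A(f)[Y]=S$. If $S$ has a unique minimal $\mathcal A(f)$-system of generators, it is denoted $\operatorname{msg}_{\mathcal A(f)}(S)$. *)

theory Defs
  imports "HOL-Analysis.Analysis"
begin

definition real_vec :: "nat ^ 'p::finite \<Rightarrow> real ^ 'p"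
  where "real_vec x = (\<chi> i. real (x $ i))"

definition int_vec :: "nat ^ 'p::finite \<Rightarrow> int ^ 'p"
  where "int_vec x = (\<chi> i. int (x $ i))"

definition integer_cone :: "(nat ^ 'p::finite) set \<Rightarrow> bool"
  where "integer_cone C \<longleftrightarrow>
    (\<exists>G :: (real ^ 'p) set. finite G \<and> (\<forall>g\<in>G. \<forall>i. g $ i \<in> \<rat>) \<and>
       C = {x. real_vec x \<in> convex_cone hull G})"

(* The rays are taken in the real cone spanned by C, which lies in the nonnegative
   orthant and is therefore pointed; for an integer cone there are finitely many,
   so that their cardinality is meaningful. *)
definition extremal_rays :: "(nat ^ 'p::finite) set \<Rightarrow> (real ^ 'p) set set"
  where "extremal_rays C =
    {R. R face_of (convex_cone hull (real_vec ` C)) \<and>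
        (\<exists>v. v \<noteq> 0 \<and> R = {t *\<^sub>R v |t. 0 \<le> t})}"

definition add_submonoid :: "'a::monoid_add set \<Rightarrow> bool"
  where "add_submonoid S \<longleftrightarrow> 0 \<in> S \<and> (\<forall>x\<in>S. \<forall>y\<in>S. x + y \<in> S)"

definition minimal_generating_set :: "'a::monoid_add set \<Rightarrow> 'a set \<Rightarrow> bool"
  where "minimal_generating_set X S \<longleftrightarrow>
    add_submonoid hull X = S \<and> (\<forall>Y. Y \<subset> X \<longrightarrow> add_submonoid hull Y \<noteq> S)"

definition msg :: "'a::monoid_add set \<Rightarrow> 'a set"
  where "msg S = (THE X. minimal_generating_set X S)"

definition gaps :: "(nat ^ 'p::finite) set \<Rightarrow> (nat ^ 'p) set \<Rightarrow> (nat ^ 'p) set"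
  where "gaps C S = C - S"

definition C_semigroup :: "(nat ^ 'p::finite) set \<Rightarrow> (nat ^ 'p) set \<Rightarrow> bool"
  where "C_semigroup C S \<longleftrightarrow>
    S \<subseteq> C \<and> add_submonoid S \<and> (\<exists>X. finite X \<and> add_submonoid hull X = S) \<and>
    integer_cone C \<and> (\<forall>D. integer_cone D \<and> S \<subseteq> D \<longrightarrow> C \<subseteq> D) \<and>
    finite (gaps C S)"

definition strict :: "('a \<Rightarrow> 'a \<Rightarrow> bool) \<Rightarrow> 'a \<Rightarrow> 'a \<Rightarrow> bool"
  where "strict le x y \<longleftrightarrow> le x y \<and> x \<noteq> y"

definition monomial_order :: "(nat ^ 'p::finite \<Rightarrow> nat ^ 'p \<Rightarrow> bool) \<Rightarrow> bool"
  where "monomial_order le \<longleftrightarrow>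
    class.linorder le (strict le) \<and>
    (\<forall>x y z. le x y \<longrightarrow> le (x + z) (y + z)) \<and> (\<forall>x. le 0 x)"

definition Fb :: "(nat ^ 'p::finite) set \<Rightarrow> (nat ^ 'p \<Rightarrow> nat ^ 'p \<Rightarrow> bool) \<Rightarrow> (nat ^ 'p) set
    \<Rightarrow> int ^ 'p"
  where "Fb C le S =
    (if gaps C S = {} then - (\<Sum>e\<in>cart_basis. e)
     else int_vec (THE m. m \<in> gaps C S \<and> (\<forall>x\<in>gaps C S. le x m)))"

(* If Fb is the vector with all entries -1, the set below is empty. This agrees with
   the unique translation-compatible extension of the order to integer vectors, for
   which every x in N^p is above that vector. *)
definition small_elements :: "(nat ^ 'p::finite) set \<Rightarrow> (nat ^ 'p \<Rightarrow> nat ^ 'p \<Rightarrow> bool)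
    \<Rightarrow> (nat ^ 'p) set \<Rightarrow> (nat ^ 'p) set"
  where "small_elements C le S = {x \<in> S. \<exists>b. int_vec b = Fb C le S \<and> strict le x b}"

definition A_semigroup :: "(nat ^ 'p::finite) set \<Rightarrow> (nat ^ 'p \<Rightarrow> nat ^ 'p \<Rightarrow> bool)
    \<Rightarrow> (nat ^ 'p) set \<Rightarrow> bool"
  where "A_semigroup C le S \<longleftrightarrow>
    C_semigroup C S \<and> (\<forall>s\<in>S. \<forall>e\<in>cart_basis. \<not> {s, s + e} \<subseteq> small_elements C le S)"

definition A_family :: "(nat ^ 'p::finite) set \<Rightarrow> (nat ^ 'p \<Rightarrow> nat ^ 'p \<Rightarrow> bool) \<Rightarrow> nat ^ 'p
    \<Rightarrow> (nat ^ 'p) set set"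
  where "A_family C le f = {S. A_semigroup C le S \<and> Fb C le S = int_vec f}"

definition Delta :: "(nat ^ 'p::finite) set \<Rightarrow> (nat ^ 'p \<Rightarrow> nat ^ 'p \<Rightarrow> bool) \<Rightarrow> nat ^ 'p
    \<Rightarrow> (nat ^ 'p) set"
  where "Delta C le f = {0} \<union> {x \<in> C. strict le f x}"

definition A_set :: "(nat ^ 'p::finite) set \<Rightarrow> (nat ^ 'p \<Rightarrow> nat ^ 'p \<Rightarrow> bool) \<Rightarrow> nat ^ 'p
    \<Rightarrow> (nat ^ 'p) set \<Rightarrow> bool"
  where "A_set C le f X \<longleftrightarrow> X \<inter> Delta C le f = {} \<and> (\<exists>S\<in>A_family C le f. X \<subseteq> S)"

definition A_closure :: "(nat ^ 'p::finite) set \<Rightarrow> (nat ^ 'p \<Rightarrow> nat ^ 'p \<Rightarrow> bool) \<Rightarrow> nat ^ 'p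
    \<Rightarrow> (nat ^ 'p) set \<Rightarrow> (nat ^ 'p) set"
  where "A_closure C le f X = \<Inter>{S \<in> A_family C le f. X \<subseteq> S}"

definition A_system :: "(nat ^ 'p::finite) set \<Rightarrow> (nat ^ 'p \<Rightarrow> nat ^ 'p \<Rightarrow> bool) \<Rightarrow> nat ^ 'p
    \<Rightarrow> (nat ^ 'p) set \<Rightarrow> (nat ^ 'p) set \<Rightarrow> bool"
  where "A_system C le f X S \<longleftrightarrow> A_set C le f X \<and> S = A_closure C le f X"

definition minimal_A_system :: "(nat ^ 'p::finite) set \<Rightarrow> (nat ^ 'p \<Rightarrow> nat ^ 'p \<Rightarrow> bool)
    \<Rightarrow> nat ^ 'p \<Rightarrow> (nat ^ 'p) set \<Rightarrow> (nat ^ 'p) set \<Rightarrow> bool"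
  where "minimal_A_system C le f X S \<longleftrightarrow>
    A_system C le f X S \<and> (\<forall>Y. Y \<subset> X \<longrightarrow> A_closure C le f Y \<noteq> S)"

definition msg_A :: "(nat ^ 'p::finite) set \<Rightarrow> (nat ^ 'p \<Rightarrow> nat ^ 'p \<Rightarrow> bool) \<Rightarrow> nat ^ 'p
    \<Rightarrow> (nat ^ 'p) set \<Rightarrow> (nat ^ 'p) set"
  where "msg_A C le f S = (THE X. minimal_A_system C le f X S)"

end

theory Submission
  imports Defs
begin

text \<open>
  A minimal generator \<open>x\<close> of \<open>S\<close> is the same thing as an atom of \<open>S\<close>: a non-zero element that is
  not a sum of two non-zero elements of \<open>S\<close>. Atoms are exactly the elements whose removal leaves
  a submonoid, so every generating set contains them, and by descent on the coordinate sum they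
  generate.

  The same two facts, one level up, give the theorem. Every member of \<open>\<A>(f)\<close> contains all of
  \<open>\<Delta>(f)\<close>, so a member that contains the atoms of \<open>S\<close> below \<open>f\<close> contains all atoms of \<open>S\<close>, hence \<open>S\<close>
  itself: the atoms below \<open>f\<close> form an \<open>\<A>(f)\<close>-system of generators. Conversely, if \<open>x\<close> is an atom
  of \<open>S\<close> below \<open>f\<close>, then \<open>S - {x}\<close> is again in \<open>\<A>(f)\<close> (\<open>A_family_remove_atom\<close>), so a subset of \<open>S\<close> that
  misses \<open>x\<close> has its closure inside \<open>S - {x}\<close>. Thus the atoms below \<open>f\<close> lie in every
  \<open>\<A>(f)\<close>-system of generators of \<open>S\<close>, and a generating system contained in all others is the
  unique minimal one.

  The substance is therefore the removal step, whose only delicate points are that \<open>S - {x}\<close>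
  remains finitely generated and that it still spans the cone; the latter holds because
  \<open>x + x\<close> survives and lies on the same ray as \<open>x\<close>.
\<close>

section \<open>Atoms of a submonoid\<close>

lemma add_submonoid_hull: "add_submonoid (add_submonoid hull X)"
  by (rule hull_in) (auto simp: add_submonoid_def)

lemma hull_subset_add_submonoid: "add_submonoid S \<Longrightarrow> X \<subseteq> S \<Longrightarrow> add_submonoid hull X \<subseteq> S"
  by (rule hull_minimal)

definition atoms :: "'a::monoid_add set \<Rightarrow> 'a set"
  where "atoms S = {x \<in> S. x \<noteq> 0 \<and> (\<forall>a\<in>S. \<forall>b\<in>S. a + b = x \<longrightarrow> a = 0 \<or> b = 0)}"

lemma add_submonoid_remove_atom:
  assumes "add_submonoid S" "x \<in> atoms S"
  shows "add_submonoid (S - {x})"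
  unfolding add_submonoid_def
proof (intro conjI ballI)
  show "0 \<in> S - {x}"
    using assms by (auto simp: add_submonoid_def atoms_def)
next
  fix a b assume ab: "a \<in> S - {x}" "b \<in> S - {x}"
  have "a + b \<noteq> x"
  proof
    assume "a + b = x"
    then have "a = 0 \<or> b = 0" using ab assms(2) by (auto simp: atoms_def)
    then show False using \<open>a + b = x\<close> ab by auto
  qed
  then show "a + b \<in> S - {x}" using ab assms(1) by (auto simp: add_submonoid_def)
qed

lemma atoms_subset_generators:
  assumes "add_submonoid hull Y = S"
  shows "atoms S \<subseteq> Y"
proof
  fix x assume x: "x \<in> atoms S"
  have S: "add_submonoid S" using add_submonoid_hull[of Y] assms by simp
  have "Y \<subseteq> S" using assms hull_subset[of Y add_submonoid] by simp
  show "x \<in> Y"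
  proof (rule ccontr)
    assume "x \<notin> Y"
    then have "add_submonoid hull Y \<subseteq> S - {x}"
      using \<open>Y \<subseteq> S\<close> by (intro hull_subset_add_submonoid add_submonoid_remove_atom S x) auto
    then show False using assms x by (auto simp: atoms_def)
  qed
qed

text \<open>
  A non-zero element that is not an atom splits into two summands of strictly smaller
  coordinate sum, so the splitting terminates.
\<close>

lemma hull_atoms:
  fixes S :: "(nat ^ 'p::finite) set"
  assumes S: "add_submonoid S"
  shows "add_submonoid hull (atoms S) = S"
proof
  show "add_submonoid hull (atoms S) \<subseteq> S"
    by (rule hull_subset_add_submonoid[OF S]) (auto simp: atoms_def)
next
  let ?deg = "\<lambda>x :: nat ^ 'p. \<Sum>i\<in>UNIV. x $ i"
  have deg_add: "?deg (a + b) = ?deg a + ?deg b" for a b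
    by (simp add: sum.distrib)
  have deg_pos: "?deg a > 0" if "a \<noteq> 0" for a
    using that by (auto simp: vec_eq_iff intro!: Nat.gr0I)
  have sub: "add_submonoid (add_submonoid hull (atoms S))"
    by (rule add_submonoid_hull)
  have "x \<in> S \<longrightarrow> x \<in> add_submonoid hull (atoms S)" for x
  proof (induction "?deg x" arbitrary: x rule: less_induct)
    case less
    show ?case
    proof
      assume "x \<in> S"
      consider "x = 0" | "x \<in> atoms S" | a b where "a \<in> S" "b \<in> S" "a + b = x" "a \<noteq> 0" "b \<noteq> 0"
        using \<open>x \<in> S\<close> by (auto simp: atoms_def)
      then show "x \<in> add_submonoid hull (atoms S)"
      proof cases
        case 1
        then show ?thesis using sub by (simp add: add_submonoid_def)
      next
        case 2
        then show ?thesis by (rule hull_inc)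
      next
        case 3
        then have "?deg a < ?deg x" "?deg b < ?deg x"
          using deg_add[of a b] deg_pos[of a] deg_pos[of b] by auto
        then have "a \<in> add_submonoid hull (atoms S)" "b \<in> add_submonoid hull (atoms S)"
          using less 3 by blast+
        then show ?thesis using sub 3(3) by (auto simp: add_submonoid_def)
      qed
    qed
  qed
  then show "S \<subseteq> add_submonoid hull (atoms S)" by blast
qed

lemma msg_eq_atoms:
  fixes S :: "(nat ^ 'p::finite) set"
  assumes "add_submonoid S"
  shows "msg S = atoms S"
proof -
  have gen: "add_submonoid hull (atoms S) = S" by (rule hull_atoms[OF assms])
  have "minimal_generating_set (atoms S) S"
    unfolding minimal_generating_set_def
    using gen atoms_subset_generators[of _ S] by auto
  moreover have "X = atoms S" if X: "minimal_generating_set X S" for X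
  proof -
    have "atoms S \<subseteq> X"
      using X by (intro atoms_subset_generators) (simp add: minimal_generating_set_def)
    moreover have "\<not> atoms S \<subset> X"
      using X gen by (auto simp: minimal_generating_set_def)
    ultimately show ?thesis by blast
  qed
  ultimately show ?thesis unfolding msg_def by (rule the_equality)
qed

section \<open>Removing an atom\<close>

text \<open>
  If \<open>X\<close> generates \<open>S\<close>, then \<open>S - {x}\<close> is generated by the elements other than \<open>x\<close> among \<open>m\<close>, \<open>x + m\<close>
  for \<open>m \<in> X\<close>, and \<open>2x\<close>, \<open>3x\<close>: a sum that uses \<open>x\<close> at least twice can be regrouped into copies of
  \<open>2x\<close> and \<open>3x\<close>, and a single \<open>x\<close> is absorbed by any other summand. The proof shows that the
  monoid \<open>H\<close> generated in this way becomes closed under addition when \<open>x\<close> is put back.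
\<close>

lemma finitely_generated_remove_element:
  fixes S :: "'a::comm_monoid_add set"
  assumes X: "finite X" "add_submonoid hull X = S"
    and x: "x \<in> S" and sub: "add_submonoid (S - {x})"
  shows "\<exists>Y. finite Y \<and> add_submonoid hull Y = S - {x}"
proof -
  define G where "G = (X \<union> (+) x ` X \<union> {x + x, x + x + x}) - {x}"
  define H where "H = add_submonoid hull G"
  have S: "add_submonoid S" using add_submonoid_hull[of X] X(2) by simp
  have addS: "a + b \<in> S" if "a \<in> S" "b \<in> S" for a b
    using S that by (auto simp: add_submonoid_def)
  have "X \<subseteq> S" using X(2) hull_subset[of X add_submonoid] by simp
  have addH: "a + b \<in> H" if "a \<in> H" "b \<in> H" for a b
    using add_submonoid_hull[of G] that by (auto simp: add_submonoid_def H_def)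
  have H0: "0 \<in> H"
    using add_submonoid_hull[of G] by (auto simp: add_submonoid_def H_def)
  have GH: "g \<in> H" if "g \<in> G" for g
    unfolding H_def using that by (rule hull_inc)
  have XH: "m \<in> insert x H" "x + m \<in> insert x H" if "m \<in> X" for m
    using that GH by (auto simp: G_def)
  have x2: "x + x \<in> insert x H" and x3: "x + x + x \<in> insert x H"
    using GH by (auto simp: G_def)
  have gen: "g + x \<in> insert x H" if g: "g \<in> G" for g
  proof -
    consider "g \<in> X" | m where "m \<in> X" "g = x + m" | "g = x + x" | "g = x + x + x"
      using g by (auto simp: G_def)
    then show ?thesis
    proof cases
      case 1
      then show ?thesis using XH(2) by (simp add: add.commute)
    next
      case (2 m)
      have eq: "g + x = (x + x) + m" using 2 by (simp add: ac_simps)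
      show ?thesis
      proof (cases "x + x = x \<or> m = x")
        case True
        then show ?thesis using eq XH(2)[OF 2(1)] x3 by auto
      next
        case False
        then show ?thesis using eq x2 XH(1)[OF 2(1)] addH[of "x + x" m] by auto
      qed
    next
      case 3
      then show ?thesis using x3 by simp
    next
      case 4
      have eq: "g + x = (x + x) + (x + x)" using 4 by (simp add: ac_simps)
      show ?thesis using eq x2 addH[of "x + x" "x + x"] by auto
    qed
  qed
  have shift: "h \<in> H \<and> h + x \<in> insert x H" if "h \<in> H" for h
    using that unfolding H_def
  proof (rule hull_induct)
    show "g \<in> add_submonoid hull G \<and> g + x \<in> insert x (add_submonoid hull G)" if "g \<in> G" for g
      using gen[OF that] GH[OF that] unfolding H_def by simp
  next
    have "a + b + x \<in> insert x H" if "a \<in> H" "a + x \<in> insert x H" "b + x \<in> insert x H" for a b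
      using that addH[of a "b + x"] by (auto simp: add.assoc)
    then show "add_submonoid {h. h \<in> add_submonoid hull G \<and> h + x \<in> insert x (add_submonoid hull G)}"
      unfolding H_def[symmetric] add_submonoid_def using H0 addH by auto
  qed
  have "add_submonoid (insert x H)"
    unfolding add_submonoid_def
  proof (intro conjI ballI)
    show "0 \<in> insert x H" using H0 by simp
    fix a b assume "a \<in> insert x H" "b \<in> insert x H"
    then show "a + b \<in> insert x H"
      using shift[of a] shift[of b] x2 addH[of a b] by (auto simp: add.commute)
  qed
  then have "S \<subseteq> insert x H"
    using X(2) XH(1) hull_subset_add_submonoid[of "insert x H" X] by auto
  moreover have "H \<subseteq> S - {x}"
    unfolding H_def using \<open>X \<subseteq> S\<close> x
    by (intro hull_subset_add_submonoid[OF sub]) (auto simp: G_def intro!: addS)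
  ultimately have "H = S - {x}" by blast
  moreover have "finite G" using X(1) by (simp add: G_def)
  ultimately show ?thesis unfolding H_def by blast
qed

lemma integer_cone_halve:
  assumes "integer_cone D" "x + x \<in> D"
  shows "x \<in> D"
proof -
  obtain G where D: "D = {x. real_vec x \<in> convex_cone hull G}"
    using assms(1) by (auto simp: integer_cone_def)
  have "real_vec (x + x) \<in> convex_cone hull G" using assms(2) D by auto
  then have "(1/2) *\<^sub>R real_vec (x + x) \<in> convex_cone hull G"
    by (rule convex_cone_hull_mul) simp
  moreover have "(1/2) *\<^sub>R real_vec (x + x) = real_vec x"
    by (simp add: real_vec_def vec_eq_iff)
  ultimately show ?thesis using D by simp
qed

lemma C_semigroup_remove_atom:
  assumes S: "C_semigroup C S" and x: "x \<in> atoms S"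
  shows "C_semigroup C (S - {x})"
proof -
  have sub: "add_submonoid S" and SC: "S \<subseteq> C" and C: "integer_cone C"
    and min: "\<And>D. integer_cone D \<Longrightarrow> S \<subseteq> D \<Longrightarrow> C \<subseteq> D"
    and fin: "finite (gaps C S)"
    using S by (auto simp: C_semigroup_def)
  obtain X where X: "finite X" "add_submonoid hull X = S"
    using S by (auto simp: C_semigroup_def)
  have xS: "x \<in> S" "x \<noteq> 0" using x by (auto simp: atoms_def)
  have sub': "add_submonoid (S - {x})"
    by (rule add_submonoid_remove_atom[OF sub x])
  have x2: "x + x \<in> S - {x}"
    using xS sub by (auto simp: add_submonoid_def)
  have "C \<subseteq> D" if "integer_cone D" "S - {x} \<subseteq> D" for D
  proof -
    have "x \<in> D" using integer_cone_halve x2 that by blast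
    then show ?thesis using that min by blast
  qed
  moreover have "finite (gaps C (S - {x}))"
    by (rule finite_subset[of _ "insert x (gaps C S)"]) (use fin in \<open>auto simp: gaps_def\<close>)
  ultimately show ?thesis
    using sub' SC C finitely_generated_remove_element[OF X xS(1) sub']
    unfolding C_semigroup_def by blast
qed

section \<open>The Frobenius element\<close>

lemma int_vec_inject: "int_vec x = int_vec y \<longleftrightarrow> x = y"
  by (simp add: int_vec_def vec_eq_iff)

lemma linorder_monomial_order: "monomial_order le \<Longrightarrow> class.linorder le (strict le)"
  by (simp add: monomial_order_def)

text \<open>
  The value of \<open>Fb\<close> for an empty set of gaps has no positive entry, so it is not \<open>int_vec f\<close>
  when \<open>f \<noteq> 0\<close>.
\<close>

lemma Fb_eq_int_vec_iff:
  assumes le: "monomial_order le" and fin: "finite (gaps C S)" and f: "f \<noteq> 0"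
  shows "Fb C le S = int_vec f \<longleftrightarrow> f \<in> gaps C S \<and> (\<forall>x\<in>gaps C S. le x f)"
proof (cases "gaps C S = {}")
  case True
  obtain i where i: "f $ i \<noteq> 0" using f by (auto simp: vec_eq_iff)
  have "0 \<le> (\<Sum>e\<in>(cart_basis :: (int ^ 'a) set). e $ i)"
    by (rule sum_nonneg) (auto simp: cart_basis_def axis_def)
  then have "(- (\<Sum>e\<in>(cart_basis :: (int ^ 'a) set). e)) $ i \<noteq> int_vec f $ i"
    using i by (simp add: int_vec_def)
  then have "- (\<Sum>e\<in>(cart_basis :: (int ^ 'a) set). e) \<noteq> int_vec f" by metis
  then show ?thesis using True by (simp add: Fb_def)
next
  case False
  interpret ord: linorder le "strict le" by (rule linorder_monomial_order[OF le])
  have max: "(THE m. m \<in> gaps C S \<and> (\<forall>x\<in>gaps C S. le x m)) = g"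
    if "g \<in> gaps C S" "\<forall>x\<in>gaps C S. le x g" for g
    using that by (intro the_equality) (auto intro: ord.order.antisym)
  define g where "g = ord.Max (gaps C S)"
  have g: "g \<in> gaps C S" "\<forall>x\<in>gaps C S. le x g"
    unfolding g_def using fin False by auto
  have "Fb C le S = int_vec g" using max[OF g] False by (simp add: Fb_def)
  then have "Fb C le S = int_vec f \<longleftrightarrow> g = f" by (simp add: int_vec_inject)
  also have "\<dots> \<longleftrightarrow> f \<in> gaps C S \<and> (\<forall>x\<in>gaps C S. le x f)"
    using g by (auto intro: ord.order.antisym)
  finally show ?thesis .
qed

lemma small_elements_eq:
  assumes "Fb C le S = int_vec f"
  shows "small_elements C le S = {x \<in> S. strict le x f}"
  using assms by (auto simp: small_elements_def int_vec_inject)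

lemma A_familyD:
  assumes "monomial_order le" "f \<noteq> 0" "S \<in> A_family C le f"
  shows "C_semigroup C S" "add_submonoid S" "S \<subseteq> C" "finite (gaps C S)"
    "f \<in> gaps C S" "\<And>x. x \<in> gaps C S \<Longrightarrow> le x f"
proof -
  have "Fb C le S = int_vec f" and CS: "C_semigroup C S"
    using assms(3) by (auto simp: A_family_def A_semigroup_def)
  then have "f \<in> gaps C S \<and> (\<forall>x\<in>gaps C S. le x f)"
    using Fb_eq_int_vec_iff[OF assms(1) _ assms(2)] by (auto simp: C_semigroup_def)
  then show "f \<in> gaps C S" "\<And>x. x \<in> gaps C S \<Longrightarrow> le x f" by blast+
  show "C_semigroup C S" "add_submonoid S" "S \<subseteq> C" "finite (gaps C S)"
    using CS by (auto simp: C_semigroup_def)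
qed

lemma Delta_subset_A_family:
  assumes le: "monomial_order le" and f: "f \<noteq> 0" and S: "S \<in> A_family C le f"
  shows "Delta C le f \<subseteq> S"
proof
  interpret ord: linorder le "strict le" by (rule linorder_monomial_order[OF le])
  fix x assume "x \<in> Delta C le f"
  then consider "x = 0" | "x \<in> C" "strict le f x" by (auto simp: Delta_def)
  then show "x \<in> S"
  proof cases
    case 1
    then show ?thesis using A_familyD(2)[OF assms] by (simp add: add_submonoid_def)
  next
    case 2
    then show ?thesis using A_familyD(6)[OF assms, of x] by (auto simp: gaps_def dest: ord.leD)
  qed
qed

text \<open>
  Removing an atom below \<open>f\<close> creates one new gap, which does not exceed \<open>f\<close>, so the Frobenius
  element is preserved; and the defining condition on pairs \<open>{s, s + e}\<close> of small elements is
  inherited because the set of small elements only shrinks.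
\<close>

lemma A_family_remove_atom:
  assumes le: "monomial_order le" and f: "f \<noteq> 0" and S: "S \<in> A_family C le f"
    and x: "x \<in> atoms S" and less: "strict le x f"
  shows "S - {x} \<in> A_family C le f"
proof -
  note SD = A_familyD[OF le f S]
  have FbS: "Fb C le S = int_vec f" using S by (simp add: A_family_def)
  have CS': "C_semigroup C (S - {x})"
    by (rule C_semigroup_remove_atom[OF SD(1) x])
  have gaps: "gaps C (S - {x}) = insert x (gaps C S)"
    using x SD(3) by (auto simp: gaps_def atoms_def)
  have Fb: "Fb C le (S - {x}) = int_vec f"
    using SD(4-6) less gaps by (subst Fb_eq_int_vec_iff[OF le _ f]) (auto simp: strict_def)
  have "small_elements C le (S - {x}) \<subseteq> small_elements C le S"
    unfolding small_elements_eq[OF Fb] small_elements_eq[OF FbS] by auto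
  then have "A_semigroup C le (S - {x})"
    using S CS' by (fastforce simp: A_family_def A_semigroup_def)
  then show ?thesis using Fb by (simp add: A_family_def)
qed

section \<open>Minimal systems of generators\<close>

lemma A_closure_small_atoms:
  assumes le: "monomial_order le" and f: "f \<noteq> 0" and S: "S \<in> A_family C le f"
  shows "A_closure C le f (small_elements C le S \<inter> atoms S) = S"
proof
  show "A_closure C le f (small_elements C le S \<inter> atoms S) \<subseteq> S"
    using S by (auto simp: A_closure_def atoms_def)
next
  interpret ord: linorder le "strict le" by (rule linorder_monomial_order[OF le])
  note SD = A_familyD[OF le f S]
  have small: "small_elements C le S = {x \<in> S. strict le x f}"
    using S by (intro small_elements_eq) (simp add: A_family_def)
  have "S \<subseteq> T" if T: "T \<in> A_family C le f" "small_elements C le S \<inter> atoms S \<subseteq> T" for T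
  proof -
    have "atoms S \<subseteq> T"
    proof
      fix x assume x: "x \<in> atoms S"
      then have "x \<in> S" "x \<in> C" "x \<noteq> f" using SD(3,5) by (auto simp: atoms_def gaps_def)
      then consider "strict le x f" | "strict le f x" using ord.linorder_cases by blast
      then show "x \<in> T"
      proof cases
        case 1
        then show ?thesis using x T(2) small \<open>x \<in> S\<close> by auto
      next
        case 2
        then have "x \<in> Delta C le f" using \<open>x \<in> C\<close> by (simp add: Delta_def)
        then show ?thesis using Delta_subset_A_family[OF le f T(1)] by auto
      qed
    qed
    then have "add_submonoid hull (atoms S) \<subseteq> T"
      using A_familyD(2)[OF le f T(1)] by (intro hull_subset_add_submonoid)
    then show ?thesis using hull_atoms[OF SD(2)] by simp
  qed
  then show "S \<subseteq> A_closure C le f (small_elements C le S \<inter> atoms S)"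
    by (auto simp: A_closure_def)
qed

lemma small_atoms_subset_of_A_closure_eq:
  assumes le: "monomial_order le" and f: "f \<noteq> 0" and S: "S \<in> A_family C le f"
    and X: "A_closure C le f X = S"
  shows "small_elements C le S \<inter> atoms S \<subseteq> X"
proof
  fix x assume "x \<in> small_elements C le S \<inter> atoms S"
  moreover have "small_elements C le S = {x \<in> S. strict le x f}"
    using S by (intro small_elements_eq) (simp add: A_family_def)
  ultimately have x: "x \<in> S" "x \<in> atoms S" "strict le x f" by auto
  have XS: "X \<subseteq> S" using X by (auto simp: A_closure_def)
  show "x \<in> X"
  proof (rule ccontr)
    assume "x \<notin> X"
    then have "A_closure C le f X \<subseteq> S - {x}"
      using XS A_family_remove_atom[OF le f S x(2,3)] unfolding A_closure_def by blast
    then show False using X x(1) by blast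
  qed
qed

lemma A_set_small_atoms:
  assumes le: "monomial_order le" and S: "S \<in> A_family C le f"
  shows "A_set C le f (small_elements C le S \<inter> atoms S)"
proof -
  interpret ord: linorder le "strict le" by (rule linorder_monomial_order[OF le])
  have "small_elements C le S = {x \<in> S. strict le x f}"
    using S by (intro small_elements_eq) (simp add: A_family_def)
  then have "small_elements C le S \<inter> atoms S \<inter> Delta C le f = {}"
    by (auto simp: Delta_def atoms_def dest: ord.less_asym)
  then show ?thesis using S by (auto simp: A_set_def atoms_def)
qed

theorem theorem9:
  fixes C :: "(nat ^ 'p::finite) set"
    and le :: "nat ^ 'p \<Rightarrow> nat ^ 'p \<Rightarrow> bool"
    and f :: "nat ^ 'p"
    and S :: "(nat ^ 'p) set"
  assumes "integer_cone C"
    and "card (extremal_rays C) \<ge> CARD('p)"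
    and "monomial_order le"
    and "\<And>k. k \<in> C \<Longrightarrow> finite {x \<in> C. le x k}"
    and "f \<in> C - {0}"
    and "S \<in> A_family C le f"
  shows "(\<exists>!X. minimal_A_system C le f X S) \<and>
         msg_A C le f S = small_elements C le S \<inter> msg S"
proof -
  have f: "f \<noteq> 0" using assms(5) by simp
  have msg: "msg S = atoms S"
    by (rule msg_eq_atoms[OF A_familyD(2)[OF assms(3) f assms(6)]])
  define M where "M = small_elements C le S \<inter> msg S"
  have cl: "A_closure C le f M = S"
    unfolding M_def msg by (rule A_closure_small_atoms[OF assms(3) f assms(6)])
  have least: "M \<subseteq> X" if "A_closure C le f X = S" for X
    unfolding M_def msg by (rule small_atoms_subset_of_A_closure_eq[OF assms(3) f assms(6) that])
  have "A_set C le f M"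
    unfolding M_def msg by (rule A_set_small_atoms[OF assms(3,6)])
  then have min: "minimal_A_system C le f M S"
    using cl least unfolding minimal_A_system_def A_system_def by blast
  have unique: "X = M" if "minimal_A_system C le f X S" for X
    using that cl least[of X] unfolding minimal_A_system_def A_system_def by blast
  have "msg_A C le f S = M"
    unfolding msg_A_def using min unique by (rule the_equality)
  then show ?thesis using min unique M_def by blast
qed

end
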